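(* Let $n$ be a nonnegative integer. Then $$\sum_{k=0}^n \frac{q^{n-k}}{(-q;q)_k^2\,(-q;q)_{n-k}^2} \begin{bmatrix} 2k\\ k\end{bmatrix}_q \begin{bmatrix} 2n-2k\\ n-k\end{bmatrix}_q = 1.$$
   Context: $q$ is an indeterminate; identities are in the field of rational functions in $q$. $(a;q)_0=1$ and $(a;q)_n=\prod_{k=0}^{n-1}(1-aq^k)$ for $n\ge 1$. $[i]_q=\frac{1-q^i}{1-q}$, $[k]_q!=\prod_{i=1}^k [i]_q$, and $\begin{bmatrix} n\\k\end{bmatrix}_q=\frac{[n]_q!}{[k]_q![n-k]_q!}$ for $0\le k\le n$. *)

theory Defs
  imports "HOL-Computational_Algebra.Polynomial" "HOL-Computational_Algebra.Fraction_Field"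
begin

definition indeterminate :: "'a::field_char_0 poly fract" where
  "indeterminate = Fract [:0, 1:] 1"

definition qpochhammer :: "'a::comm_ring_1 \<Rightarrow> 'a \<Rightarrow> nat \<Rightarrow> 'a" where
  "qpochhammer a q n = (\<Prod>k<n. 1 - a * q ^ k)"

definition qint :: "'a::field \<Rightarrow> nat \<Rightarrow> 'a" where
  "qint q i = (1 - q ^ i) / (1 - q)"

definition qfact :: "'a::field \<Rightarrow> nat \<Rightarrow> 'a" where
  "qfact q k = (\<Prod>i=1..k. qint q i)"

text \<open>The case split only guards against truncated subtraction: the value for \<open>k > n\<close> is a convention.\<close>

definition qbinomial :: "'a::field \<Rightarrow> nat \<Rightarrow> nat \<Rightarrow> 'a" where
  "qbinomial q n k = (if k \<le> n then qfact q n / (qfact q k * qfact q (n - k)) else 0)"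

end

theory Submission
  imports Defs "HOL-Computational_Algebra.Formal_Power_Series"
begin

text \<open>Put \<open>a k = qbinomial q (2 * k) k / (qpochhammer (- q) q k)\<^sup>2\<close>, which equals
  \<open>(q;q\<^sup>2)\<^sub>k / (q\<^sup>2;q\<^sup>2)\<^sub>k\<close>. Its generating function \<open>A\<close> satisfies
  \<open>(1 - x) A(x) = (1 - q x) A(q\<^sup>2 x)\<close>. The sum in question is the \<open>n\<close>-th coefficient of
  \<open>A(x) A(q x)\<close>, and by the functional equation \<open>C(x) = (1 - x) A(x) A(q x)\<close> is invariant under
  \<open>x \<mapsto> q x\<close>. As \<open>q\<close> is not a root of unity, \<open>C\<close> is constant, so \<open>A(x) A(q x) = 1 / (1 - x)\<close>.\<close>

unbundle fps_syntax

definition central_coeff :: "'a::field \<Rightarrow> nat \<Rightarrow> 'a" where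
  "central_coeff q k = qbinomial q (2 * k) k / (qpochhammer (- q) q k)\<^sup>2"

lemma qfact_Suc: "qfact q (Suc n) = qfact q n * qint q (Suc n)"
  by (simp add: qfact_def)

lemma qpochhammer_Suc: "qpochhammer a q (Suc n) = qpochhammer a q n * (1 - a * q ^ n)"
  by (simp add: qpochhammer_def)

lemma central_coeff_0 [simp]: "central_coeff q 0 = 1"
  by (simp add: central_coeff_def qbinomial_def qpochhammer_def qfact_def)

text \<open>With \<open>y = q ^ (k + 1)\<close>, passing from \<open>k\<close> to
  \<open>k + 1\<close> multiplies the q-binomial by
  \<open>(1 - q ^ (2 * k + 1)) * (1 + y) / (1 - y)\<close> and the squared Pochhammer symbol by
  \<open>(1 + y)\<^sup>2\<close>; then \<open>1 - y\<^sup>2 = (1 - y) * (1 + y)\<close> clears the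
  denominators.\<close>

lemma central_coeff_Suc:
  fixes q :: "'a::field"
  assumes "\<And>n. 0 < n \<Longrightarrow> q ^ n \<noteq> 1"
  shows "(1 - q ^ (2 * k + 2)) * central_coeff q (Suc k) = (1 - q ^ (2 * k + 1)) * central_coeff q k"
proof -
  define y where "y = q ^ Suc k"
  have y2: "q ^ (2 * k + 2) = y\<^sup>2"
    by (simp add: y_def power2_eq_square mult_2 power_add)
  have "y\<^sup>2 \<noteq> 1"
    using assms[of "2 * k + 2"] y2 by simp
  then have "(1 - y) * (1 + y) \<noteq> 0"
    by (simp add: algebra_simps power2_eq_square)
  then have nz: "1 - y \<noteq> 0" "1 + y \<noteq> 0"
    by auto
  have q1: "1 - q \<noteq> 0"
    using assms[of 1] by simp
  have pochhammer: "qpochhammer (- q) q (Suc k) = qpochhammer (- q) q k * (1 + y)"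
    by (simp add: qpochhammer_Suc y_def)
  have "qbinomial q (2 * Suc k) (Suc k)
      = qbinomial q (2 * k) k * (qint q (2 * k + 1) * qint q (2 * k + 2) / (qint q (Suc k))\<^sup>2)"
    by (simp add: qbinomial_def qfact_Suc power2_eq_square mult_ac)
  also have "qint q (2 * k + 1) * qint q (2 * k + 2) / (qint q (Suc k))\<^sup>2
      = (1 - q ^ (2 * k + 1)) * (1 - y\<^sup>2) / (1 - y)\<^sup>2"
    unfolding qint_def y2 y_def[symmetric] using q1 by (simp add: power2_eq_square)
  also have "1 - y\<^sup>2 = (1 - y) * (1 + y)"
    by (simp add: algebra_simps power2_eq_square)
  also have "(1 - q ^ (2 * k + 1)) * ((1 - y) * (1 + y)) / (1 - y)\<^sup>2
      = (1 - q ^ (2 * k + 1)) * (1 + y) / (1 - y)"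
    using nz by (simp add: power2_eq_square)
  finally have binomial: "qbinomial q (2 * Suc k) (Suc k)
      = qbinomial q (2 * k) k * ((1 - q ^ (2 * k + 1)) * (1 + y) / (1 - y))" .
  have "1 - y\<^sup>2 = (1 - y) * (1 + y)"
    by (simp add: algebra_simps power2_eq_square)
  then show ?thesis
    unfolding central_coeff_def binomial pochhammer y2
    using nz by (simp add: power2_eq_square)
qed

lemma fps_scale_nth:
  "(f oo (fps_const c * fps_X)) $ n = c ^ n * f $ n" for f :: "'a::field fps"
  by (simp add: fps_compose_linear)

lemma fps_scale_scale:
  "(f oo (fps_const c * fps_X)) oo (fps_const d * fps_X) = f oo (fps_const (c * d) * fps_X)"
  for f :: "'a::field fps"
  by (rule fps_ext) (simp only: fps_scale_nth power_mult_distrib, simp)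

text \<open>Comparing coefficients gives \<open>(q ^ n - 1) * f $ n = 0\<close>, which kills every
  term with \<open>n > 0\<close>.\<close>

lemma fps_scale_invariant:
  fixes f :: "'a::field fps"
  assumes "\<And>n. 0 < n \<Longrightarrow> q ^ n \<noteq> 1" and "f oo (fps_const q * fps_X) = f"
  shows "f = fps_const (f $ 0)"
proof (rule fps_ext)
  fix n
  have "q ^ n * f $ n = f $ n"
    using assms(2) by (metis fps_scale_nth)
  then show "f $ n = fps_const (f $ 0) $ n"
    using assms(1)[of n] by (cases "n = 0") auto
qed

lemma central_coeff_convolution:
  fixes q :: "'a::field"
  assumes "\<And>n. 0 < n \<Longrightarrow> q ^ n \<noteq> 1"
  shows "(\<Sum>k=0..n. central_coeff q k * (q ^ (n - k) * central_coeff q (n - k))) = 1"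
proof -
  define A where "A = Abs_fps (central_coeff q)"
  define X where "X = (fps_X :: 'a fps)"
  define Q where "Q = fps_const q"
  \<comment> \<open>\<open>B\<close> is A(q x) and \<open>D\<close> is A(q^2 x).\<close>
  define B where "B = A oo (Q * X)"
  define D where "D = A oo (fps_const (q * q) * X)"
  have functional: "(1 - X) * A = (1 - Q * X) * D"
  proof (rule fps_ext)
    fix m
    show "((1 - X) * A) $ m = ((1 - Q * X) * D) $ m"
    proof (cases m)
      case 0
      then show ?thesis
        by (simp add: X_def Q_def A_def D_def)
    next
      case (Suc k)
      have lhs: "((1 - X) * A) $ m = central_coeff q (Suc k) - central_coeff q k"
        by (simp add: X_def A_def Suc left_diff_distrib)
      \<comment> \<open>The exponent \<open>2 * k + 1\<close> combines \<open>q ^ (2 * k)\<close>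
        from \<open>D\<close> with the factor \<open>q\<close> from \<open>Q * X\<close>.\<close>
      have rhs: "((1 - Q * X) * D) $ m
          = q ^ (2 * k + 2) * central_coeff q (Suc k) - q ^ (2 * k + 1) * central_coeff q k"
        by (simp add: X_def Q_def A_def D_def Suc left_diff_distrib fps_scale_nth mult.assoc
            power_mult_distrib mult_2 power_add)
      show ?thesis
        unfolding lhs rhs using central_coeff_Suc[OF assms, of k] by (simp add: algebra_simps)
    qed
  qed
  define C where "C = (1 - X) * A * B"
  \<comment> \<open>The substitution sends \<open>A\<close> to \<open>B\<close> and \<open>B\<close>
    to \<open>D\<close>; the functional equation then trades \<open>(1 - Q * X) * D\<close> back for
    \<open>(1 - X) * A\<close>.\<close>
  have "C oo (Q * X) = (1 - Q * X) * B * D"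
    by (simp add: C_def B_def D_def Q_def X_def fps_compose_mult_distrib fps_compose_sub_distrib
        fps_scale_scale)
  also have "\<dots> = C"
    using functional by (simp add: C_def mult_ac)
  finally have "C = fps_const (C $ 0)"
    using fps_scale_invariant assms unfolding Q_def X_def by blast
  also have "C $ 0 = 1"
    by (simp add: C_def X_def A_def B_def Q_def)
  finally have geometric: "(1 - X) * (A * B) = 1"
    by (simp add: C_def mult.assoc)
  \<comment> \<open>Multiplication by \<open>1 - X\<close> takes differences of consecutive
    coefficients, so they all equal the constant one.\<close>
  have "(A * B) $ m = 1" for m
  proof (induction m)
    case 0
    show ?case
      by (simp add: A_def B_def Q_def X_def)
  next
    case (Suc m)
    have "((1 - X) * (A * B)) $ Suc m = 0"
      unfolding geometric by simp
    with Suc show ?case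
      by (simp add: X_def left_diff_distrib)
  qed
  from this[of n] show ?thesis
    by (simp add: fps_mult_nth A_def B_def Q_def X_def fps_scale_nth)
qed

lemma indeterminate_power: "indeterminate ^ n = Fract (monom 1 n) 1"
  by (induction n)
    (simp_all add: indeterminate_def One_fract_def monom_0 one_pCons monom_Suc)

text \<open>Degrees separate \<open>monom 1 n\<close> from the constant 1, so the indeterminate is
  not a root of unity, as the convolution identity requires.\<close>

lemma indeterminate_power_neq_1:
  assumes "0 < n"
  shows "indeterminate ^ n \<noteq> (1 :: 'a::field_char_0 poly fract)"
proof
  assume "indeterminate ^ n = (1 :: 'a poly fract)"
  then have "monom 1 n = (1 :: 'a poly)"
    by (simp add: indeterminate_power One_fract_def eq_fract)
  then have "degree (monom (1 :: 'a) n) = 0"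
    by simp
  with assms show False
    by (simp add: degree_monom_eq)
qed

theorem proposition4:
  fixes n :: nat and q :: "'a::field_char_0 poly fract"
  assumes "q = indeterminate"
  shows "(\<Sum>k=0..n. q ^ (n - k) / ((qpochhammer (- q) q k)\<^sup>2 * (qpochhammer (- q) q (n - k))\<^sup>2)
            * qbinomial q (2 * k) k * qbinomial q (2 * n - 2 * k) (n - k)) = 1"
proof -
  have "(\<Sum>k=0..n. central_coeff q k * (q ^ (n - k) * central_coeff q (n - k))) = 1"
    using central_coeff_convolution indeterminate_power_neq_1 assms by metis
  then show ?thesis
    by (simp add: central_coeff_def diff_mult_distrib mult_ac)
qed

end
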